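(* Let $G$ be a graph with $n$ vertices and $m\ge 1$ edges, let $q_1,\dots,q_n$ be the eigenvalues of its signless Laplacian matrix $Q(G)$, and let $I_Q^1(G)$, $I_\alpha^2(G)$, $I_\alpha^3(G)$ be the generalized graph entropies of $G$ formed from $q_1,\dots,q_n$. Then for every real $\alpha\neq 1$: (i) $I_Q^1(G)=1-\frac{1}{4m^2}(M_1+2m)$; (ii) $I_\alpha^2(G)=\frac{1}{1-\alpha}\log\frac{M_\alpha^*}{(2m)^\alpha}$; (iii) $I_\alpha^3(G)=\frac{1}{2^{1-\alpha}-1}\left(\frac{M_\alpha^*}{(2m)^\alpha}-1\right)$, where $M_1$ is the first Zagreb index of $G$ and $M_\alpha^*=\sum_{i=1}^n|q_i|^\alpha$.
   Context: Graphs are finite and simple, with vertices $v_1,\dots,v_n$ of degrees $d_1,\dots,d_n$. The signless Laplacian is $Q(G)=D(G)+A(G)$, where $D(G)=\mathrm{diag}(d_1,\dots,d_n)$ and $A(G)$ is the adjacency matrix. The first Zagreb index is $M_1=\sum_{i=1}^n d_i^2$. For numbers $\mu_1,\dots,\mu_n$ (listed with multiplicity) with $\sum_j|\mu_j|\neq 0$, put $p_i=|\mu_i|/\sum_{j=1}^n|\mu_j|$. The generalized graph entropies formed from $\mu_1,\dots,\mu_n$ are $I^1=\sum_{i=1}^n p_i(1-p_i)$, $\quad I^2_\alpha=\frac{1}{1-\alpha}\log\left(\sum_{i=1}^n p_i^\alpha\right)$, $\quad I^3_\alpha=\frac{\sum_{i=1}^n p_i^\alpha-1}{2^{1-\alpha}-1}$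 for $\alpha\ne1$ (real $\alpha$ for which the occurring powers are defined). Here $\log$ is the logarithm to one fixed base greater than $1$. The subscript on $I^1$ names the matrix used. *)

theory Defs
  imports Complex_Main "Jordan_Normal_Form.Char_Poly"
begin

definition simple_graph :: "'a set \<Rightarrow> 'a set set \<Rightarrow> bool" where
  "simple_graph V E \<longleftrightarrow> finite V \<and> (\<forall>e\<in>E. e \<subseteq> V \<and> card e = 2)"

definition vertex_degree :: "'a set set \<Rightarrow> 'a \<Rightarrow> nat" where
  "vertex_degree E v = card {e \<in> E. v \<in> e}"

definition first_zagreb :: "'a set \<Rightarrow> 'a set set \<Rightarrow> nat" where
  "first_zagreb V E = (\<Sum>v\<in>V. (vertex_degree E v)\<^sup>2)"

text \<open>The matrices are taken with respect to an enumeration \<open>vs\<close> of the vertices, that is,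
  a distinct list whose set is the vertex set.\<close>

definition adjacency_mat :: "'a set set \<Rightarrow> 'a list \<Rightarrow> real mat" where
  "adjacency_mat E vs = mat (length vs) (length vs)
     (\<lambda>(i, j). if {vs ! i, vs ! j} \<in> E then 1 else 0)"

definition degree_mat :: "'a set set \<Rightarrow> 'a list \<Rightarrow> real mat" where
  "degree_mat E vs = mat (length vs) (length vs)
     (\<lambda>(i, j). if i = j then real (vertex_degree E (vs ! i)) else 0)"

definition signless_laplacian :: "'a set set \<Rightarrow> 'a list \<Rightarrow> real mat" where
  "signless_laplacian E vs = degree_mat E vs + adjacency_mat E vs"

text \<open>\<open>qs\<close> lists all the eigenvalues of \<open>A\<close> with their multiplicities, in some order. For a real
  matrix such a list exists only if the characteristic polynomial splits over the reals; for the
  signless Laplacian it does, see \<open>signless_laplacian_eigenvalue_list_exists\<close> below.\<close>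

definition eigenvalue_list :: "real mat \<Rightarrow> real list \<Rightarrow> bool" where
  "eigenvalue_list A qs \<longleftrightarrow>
     length qs = dim_row A \<and> char_poly A = (\<Prod>q\<leftarrow>qs. [:- q, 1:])"

definition entropy_weight :: "real list \<Rightarrow> nat \<Rightarrow> real" where
  "entropy_weight \<mu> i = \<bar>\<mu> ! i\<bar> / (\<Sum>j<length \<mu>. \<bar>\<mu> ! j\<bar>)"

definition entropy1 :: "real list \<Rightarrow> real" where
  "entropy1 \<mu> = (\<Sum>i<length \<mu>. entropy_weight \<mu> i * (1 - entropy_weight \<mu> i))"

text \<open>Here \<open>b\<close> is the base of the logarithm. Powers with exponent \<open>\<alpha>\<close> are rendered by
  \<open>powr\<close>, for which \<open>0 powr \<alpha> = 0\<close> for every \<open>\<alpha>\<close>; this convention is relevant only for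
  \<open>\<alpha> \<le> 0\<close> in the presence of a zero eigenvalue.\<close>

definition entropy2 :: "real \<Rightarrow> real \<Rightarrow> real list \<Rightarrow> real" where
  "entropy2 b \<alpha> \<mu> = 1 / (1 - \<alpha>) * log b (\<Sum>i<length \<mu>. entropy_weight \<mu> i powr \<alpha>)"

definition entropy3 :: "real \<Rightarrow> real list \<Rightarrow> real" where
  "entropy3 \<alpha> \<mu> =
     ((\<Sum>i<length \<mu>. entropy_weight \<mu> i powr \<alpha>) - 1) / (2 powr (1 - \<alpha>) - 1)"

definition abs_power_sum :: "real \<Rightarrow> real list \<Rightarrow> real" where
  "abs_power_sum \<alpha> \<mu> = (\<Sum>i<length \<mu>. \<bar>\<mu> ! i\<bar> powr \<alpha>)"

lemma symmetric_eigenvalue_list_exists: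
  fixes A :: "real mat"
  assumes A: "A \<in> carrier_mat n n" and sym: "transpose_mat A = A"
  shows "\<exists>qs. eigenvalue_list A qs"
proof -
  define C where "C = map_mat complex_of_real A"
  have C: "C \<in> carrier_mat n n" using A by (simp add: C_def)
  have symC: "transpose_mat C = C" unfolding C_def using sym by (metis map_mat_transpose)
  obtain as where as: "char_poly C = (\<Prod>a\<leftarrow>as. [:- a, 1:])" and len: "length as = n"
    using char_poly_factorized[OF C] by blast
  have re: "a = complex_of_real (Re a)" if "a \<in> set as" for a
  proof -
    have "poly (char_poly C) a = 0"
      unfolding as poly_prod_list using that by (auto simp: prod_list_zero_iff)
    then have "eigenvalue C a" using eigenvalue_root_char_poly[OF C] by simp
    then obtain v where v: "v \<in> carrier_vec n" "v \<noteq> 0\<^sub>v n" "C *\<^sub>v v = a \<cdot>\<^sub>v v"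
      unfolding eigenvalue_def eigenvector_def using C by auto
    have cv: "conjugate v \<in> carrier_vec n" using v(1) by simp
    have Ccv: "C *\<^sub>v conjugate v = conjugate (C *\<^sub>v v)"
      using v(1) A by (intro eq_vecI) (auto simp: C_def scalar_prod_def)
    have "a * (v \<bullet>c v) = (C *\<^sub>v v) \<bullet>c v" using v by simp
    also have "\<dots> = (transpose_mat C *\<^sub>v v) \<bullet>c v" by (simp add: symC)
    also have "\<dots> = v \<bullet> (C *\<^sub>v conjugate v)"
      using transpose_vec_mult_scalar[OF C cv v(1)] by simp
    also have "\<dots> = v \<bullet> (cnj a \<cdot>\<^sub>v conjugate v)"
      unfolding Ccv v(3) by (simp add: conjugate_smult_vec)
    also have "\<dots> = cnj a * (v \<bullet>c v)" using v by simp
    finally have "a = cnj a" using v(1,2) conjugate_square_eq_0_vec by auto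
    then have "a \<in> \<real>" by (metis Reals_cnj_iff)
    then show ?thesis by simp
  qed
  define qs where "qs = map Re as"
  have as_qs: "as = map complex_of_real qs"
    unfolding qs_def using re by (simp add: map_idI[symmetric] comp_def)
  interpret h: map_poly_inj_comm_ring_hom complex_of_real ..
  have "map_poly complex_of_real (char_poly A) = char_poly C"
    unfolding C_def by (rule of_real_hom.char_poly_hom[OF A, symmetric])
  also have "\<dots> = map_poly complex_of_real (\<Prod>q\<leftarrow>qs. [:- q, 1:])"
    unfolding as as_qs by (simp add: h.hom_prod_list comp_def)
  finally have "char_poly A = (\<Prod>q\<leftarrow>qs. [:- q, 1:])"
    by (simp only: h.eq_iff)
  then have "eigenvalue_list A qs" unfolding eigenvalue_list_def using len A qs_def by simp
  then show ?thesis by blast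
qed

corollary signless_laplacian_eigenvalue_list_exists:
  "\<exists>qs. eigenvalue_list (signless_laplacian E vs) qs"
proof (rule symmetric_eigenvalue_list_exists)
  show "signless_laplacian E vs \<in> carrier_mat (length vs) (length vs)"
    by (simp add: signless_laplacian_def degree_mat_def adjacency_mat_def)
  show "transpose_mat (signless_laplacian E vs) = signless_laplacian E vs"
    by (intro eq_matI)
      (auto simp: signless_laplacian_def degree_mat_def adjacency_mat_def insert_commute)
qed

end

theory Submission
  imports Defs "Jordan_Normal_Form.Schur_Decomposition"
begin

text \<open>
  All three entropies depend on the eigenvalues \<open>q\<^sub>i\<close> of the signless Laplacian \<open>Q\<close> only through the
  normalising constant \<open>\<Sum>\<bar>q\<^sub>i\<bar>\<close> and through power sums of the \<open>\<bar>q\<^sub>i\<bar>\<close>. The quadratic form of \<open>Q\<close> is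
  a sum of squares \<open>(x\<^sub>i + x\<^sub>j)\<^sup>2\<close> over the edges, so that no \<open>q\<^sub>i\<close> is negative
  (\<open>signless_laplacian_eigenvalue_nonneg\<close>) and the absolute values disappear. The normalising
  constant is then the trace of \<open>Q\<close>, the sum of all degrees, which is \<open>2 * m\<close> by the handshake
  lemma (\<open>trace_signless_laplacian\<close>). This already yields the formulas for
  \<open>entropy2\<close> and \<open>entropy3\<close>, because dividing every
  \<open>q\<^sub>i\<close> by \<open>2 * m\<close> divides the power sum of exponent \<open>\<alpha>\<close> by \<open>(2 * m) powr \<alpha>\<close>.

  For \<open>entropy1\<close>, the weights \<open>p\<^sub>i\<close> sum to one, hence \<open>\<Sum> p\<^sub>i * (1 - p\<^sub>i) = 1 - \<Sum> p\<^sub>i\<^sup>2\<close>, and \<open>\<Sum> q\<^sub>i\<^sup>2\<close> is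
  the trace of \<open>Q\<^sup>2\<close>. As \<open>Q\<close> is symmetric, that trace is the sum of the squares of its entries: the
  diagonal contributes the Zagreb index and each edge contributes two off-diagonal ones
  (\<open>trace_signless_laplacian_square\<close>). The link between eigenvalues and traces of powers
  (\<open>mat_trace_pow_eigenvalue_list\<close>) comes from Schur triangularisation.
\<close>

section \<open>Traces of powers and eigenvalues\<close>

definition mat_trace :: "'a :: comm_monoid_add mat \<Rightarrow> 'a" where
  "mat_trace A = (\<Sum>i<dim_row A. A $$ (i, i))"

lemma mat_trace_mult:
  assumes "A \<in> carrier_mat n m" "B \<in> carrier_mat m n"
  shows "mat_trace (A * B) = (\<Sum>i<n. \<Sum>j<m. A $$ (i, j) * B $$ (j, i))"
  using assms by (auto simp: mat_trace_def scalar_prod_def atLeast0LessThan intro!: sum.cong)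

lemma mat_trace_mult_commute:
  fixes A B :: "'a :: comm_semiring_0 mat"
  assumes "A \<in> carrier_mat n m" "B \<in> carrier_mat m n"
  shows "mat_trace (A * B) = mat_trace (B * A)"
  unfolding mat_trace_mult[OF assms] mat_trace_mult[OF assms(2,1)]
  by (subst sum.swap) (simp add: mult.commute)

lemma mat_trace_similar:
  fixes A B :: "'a :: comm_ring_1 mat"
  assumes "similar_mat_wit A B P Q"
  shows "mat_trace A = mat_trace B"
proof -
  define n where "n = dim_row A"
  note wit = similar_mat_witD[OF n_def assms]
  have "mat_trace A = mat_trace (P * (B * Q))" using wit by (simp add: assoc_mult_mat)
  also have "\<dots> = mat_trace ((B * Q) * P)"
    using wit by (intro mat_trace_mult_commute[of _ n n]) auto
  also have "(B * Q) * P = B" using wit by (simp add: assoc_mult_mat[of _ n n _ n _ n])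
  finally show ?thesis .
qed

lemma upper_triangular_mult:
  fixes A B :: "'a :: semiring_1 mat"
  assumes A: "A \<in> carrier_mat n n" "upper_triangular A"
    and B: "B \<in> carrier_mat n n" "upper_triangular B"
  shows "upper_triangular (A * B)"
    and "i < n \<Longrightarrow> (A * B) $$ (i, i) = A $$ (i, i) * B $$ (i, i)"
proof -
  have entry: "(A * B) $$ (i, j) = (\<Sum>k<n. A $$ (i, k) * B $$ (k, j))" if "i < n" "j < n" for i j
    using A B that by (simp add: scalar_prod_def atLeast0LessThan)
  have zero: "A $$ (i, k) * B $$ (k, j) = 0" if "i < n" "k < n" "k < i \<or> j < k" for i j k
    using that A(1) B(1) upper_triangularD[OF A(2), of k i] upper_triangularD[OF B(2), of j k] by auto
  show "upper_triangular (A * B)"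
  proof (rule upper_triangularI)
    fix i j assume "j < i" "i < dim_row (A * B)"
    then show "(A * B) $$ (i, j) = 0"
      using A(1) by (subst entry) (auto intro!: sum.neutral zero)
  qed
  show "(A * B) $$ (i, i) = A $$ (i, i) * B $$ (i, i)" if i: "i < n"
  proof -
    have "(\<Sum>k<n. A $$ (i, k) * B $$ (k, i)) = (\<Sum>k\<in>{i}. A $$ (i, k) * B $$ (k, i))"
      using i by (intro sum.mono_neutral_right) (auto intro!: zero)
    then show ?thesis using i by (simp add: entry)
  qed
qed

lemma upper_triangular_pow:
  fixes A :: "'a :: semiring_1 mat"
  assumes "A \<in> carrier_mat n n" "upper_triangular A"
  shows "upper_triangular (A ^\<^sub>m k) \<and> (\<forall>i<n. (A ^\<^sub>m k) $$ (i, i) = (A $$ (i, i)) ^ k)"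
proof (induction k)
  case 0
  show ?case using assms by (auto intro!: upper_triangularI)
next
  case (Suc k)
  have "A ^\<^sub>m k \<in> carrier_mat n n" using assms by simp
  from upper_triangular_mult[OF this _ assms] Suc show ?case by (simp add: power_commutes)
qed

text \<open>
  Since the characteristic polynomial splits, \<open>A\<close> is similar to an upper triangular matrix with the
  listed eigenvalues on the diagonal. Similarity is preserved by powers and preserves the trace, and
  the diagonal of a power of a triangular matrix consists of the powers of its diagonal entries.
\<close>
lemma mat_trace_pow_eigenvalue_list:
  assumes A: "A \<in> carrier_mat n n" and qs: "eigenvalue_list A qs"
  shows "mat_trace (A ^\<^sub>m k) = (\<Sum>i<length qs. (qs ! i) ^ k)"
proof -
  obtain B P Q where dec: "schur_decomposition A qs = (B, P, Q)" by (cases "schur_decomposition A qs")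
  from schur_decomposition[OF A _ dec] qs
  have wit: "similar_mat_wit A B P Q" and upper: "upper_triangular B" and diag: "diag_mat B = qs"
    by (auto simp: eigenvalue_list_def)
  from wit A have B: "B \<in> carrier_mat n n" by (auto simp: similar_mat_wit_def Let_def)
  have len: "length qs = n" using diag B by (auto simp: diag_mat_def)
  have "mat_trace (A ^\<^sub>m k) = mat_trace (B ^\<^sub>m k)"
    by (rule mat_trace_similar[OF similar_mat_wit_pow[OF wit]])
  also have "\<dots> = (\<Sum>i<n. (B $$ (i, i)) ^ k)"
    using upper_triangular_pow[OF B upper, of k] B by (simp add: mat_trace_def)
  also have "\<dots> = (\<Sum>i<length qs. (qs ! i) ^ k)"
    using B by (auto simp: diag[symmetric] diag_mat_def)
  finally show ?thesis .
qed

section \<open>The signless Laplacian of a graph\<close>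

lemma adjacency_mat_carrier [simp]: "adjacency_mat E vs \<in> carrier_mat (length vs) (length vs)"
  by (simp add: adjacency_mat_def)

lemma signless_laplacian_carrier [simp]:
  "signless_laplacian E vs \<in> carrier_mat (length vs) (length vs)"
  by (simp add: signless_laplacian_def degree_mat_def)

lemma signless_laplacian_dim [simp]:
  "dim_row (signless_laplacian E vs) = length vs" "dim_col (signless_laplacian E vs) = length vs"
  using carrier_matD[OF signless_laplacian_carrier] by auto

lemma adjacency_mat_symmetric:
  "i < length vs \<Longrightarrow> j < length vs \<Longrightarrow> adjacency_mat E vs $$ (i, j) = adjacency_mat E vs $$ (j, i)"
  by (simp add: adjacency_mat_def insert_commute)

lemma adjacency_mat_idempotent_entry:
  "i < length vs \<Longrightarrow> j < length vs \<Longrightarrow>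
    adjacency_mat E vs $$ (i, j) * adjacency_mat E vs $$ (i, j) = adjacency_mat E vs $$ (i, j)"
  by (simp add: adjacency_mat_def)

lemma adjacency_mat_nonneg:
  "i < length vs \<Longrightarrow> j < length vs \<Longrightarrow> 0 \<le> adjacency_mat E vs $$ (i, j)"
  by (simp add: adjacency_mat_def)

lemma adjacency_mat_diag:
  assumes "simple_graph V E" "i < length vs"
  shows "adjacency_mat E vs $$ (i, i) = 0"
  using assms by (auto simp: adjacency_mat_def simple_graph_def)

lemma signless_laplacian_entry:
  "i < length vs \<Longrightarrow> j < length vs \<Longrightarrow> signless_laplacian E vs $$ (i, j) =
    (if i = j then real (vertex_degree E (vs ! i)) else 0) + adjacency_mat E vs $$ (i, j)"
  by (simp add: signless_laplacian_def degree_mat_def adjacency_mat_def)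

text \<open>An edge at \<open>v\<^sub>i\<close> is determined by its other endpoint, so row \<open>i\<close> counts these edges.\<close>
lemma adjacency_mat_row_sum:
  assumes G: "simple_graph V E" and vs: "distinct vs" "set vs = V" and i: "i < length vs"
  shows "(\<Sum>j<length vs. adjacency_mat E vs $$ (i, j)) = real (vertex_degree E (vs ! i))"
proof -
  let ?J = "{j. j < length vs \<and> {vs ! i, vs ! j} \<in> E}"
  have "bij_betw (\<lambda>j. {vs ! i, vs ! j}) ?J {e \<in> E. vs ! i \<in> e}"
  proof (rule bij_betw_imageI)
    show "inj_on (\<lambda>j. {vs ! i, vs ! j}) ?J"
      using vs(1) by (auto simp: inj_on_def doubleton_eq_iff nth_eq_iff_index_eq)
    show "(\<lambda>j. {vs ! i, vs ! j}) ` ?J = {e \<in> E. vs ! i \<in> e}"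
    proof (intro equalityI subsetI)
      fix e assume e: "e \<in> {e \<in> E. vs ! i \<in> e}"
      with G have "card e = 2" "e \<subseteq> V" by (auto simp: simple_graph_def)
      with e obtain w where w: "e = {vs ! i, w}" by (auto simp: card_2_iff)
      with \<open>e \<subseteq> V\<close> vs(2) obtain j where "j < length vs" "w = vs ! j"
        by (metis in_set_conv_nth insert_subset)
      with w e show "e \<in> (\<lambda>j. {vs ! i, vs ! j}) ` ?J" by auto
    qed auto
  qed
  then have "card ?J = vertex_degree E (vs ! i)" by (simp add: bij_betw_same_card vertex_degree_def)
  moreover have "(\<Sum>j<length vs. adjacency_mat E vs $$ (i, j)) =
      (\<Sum>j<length vs. if {vs ! i, vs ! j} \<in> E then 1 else 0)"
    using i by (intro sum.cong) (auto simp: adjacency_mat_def)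
  moreover have "\<dots> = real (card ?J)"
    by (subst sum.inter_filter[symmetric]) (auto intro!: arg_cong[where f = card])
  ultimately show ?thesis by simp
qed

lemma handshake:
  assumes "simple_graph V E"
  shows "(\<Sum>v\<in>V. vertex_degree E v) = 2 * card E"
proof -
  have "finite V" "E \<subseteq> Pow V" using assms by (auto simp: simple_graph_def)
  then have fin: "finite V" "finite E" by (auto dest: finite_subset)
  have "{v \<in> V. v \<in> e} = e" if "e \<in> E" for e using assms that by (auto simp: simple_graph_def)
  then have "\<forall>e\<in>E. card {v \<in> V. v \<in> e} = 2" using assms by (simp add: simple_graph_def)
  then show ?thesis unfolding vertex_degree_def by (rule sum_multicount[OF fin])
qed

lemma sum_enumeration:
  "distinct vs \<Longrightarrow> set vs = V \<Longrightarrow> (\<Sum>i<length vs. f (vs ! i)) = (\<Sum>v\<in>V. f v)"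
  by (rule sum.reindex_bij_betw) (auto intro: bij_betw_nth)

lemma sum_degrees:
  assumes "simple_graph V E" "distinct vs" "set vs = V"
  shows "(\<Sum>i<length vs. real (vertex_degree E (vs ! i))) = 2 * real (card E)"
  using sum_enumeration[OF assms(2,3), of "\<lambda>v. real (vertex_degree E v)"] handshake[OF assms(1)]
  by (simp flip: of_nat_sum)

lemma trace_signless_laplacian:
  assumes "simple_graph V E" "distinct vs" "set vs = V"
  shows "mat_trace (signless_laplacian E vs) = 2 * real (card E)"
  unfolding sum_degrees[OF assms, symmetric] mat_trace_def
  using adjacency_mat_diag[OF assms(1)]
  by (auto simp: signless_laplacian_entry intro!: sum.cong)

text \<open>
  The trace of the square sums the squared entries. Off the diagonal these are the entries of the
  adjacency matrix themselves, whose row sums are the degrees; this is the origin of the second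
  summand \<open>2 * card E\<close>.
\<close>
lemma trace_signless_laplacian_square:
  assumes G: "simple_graph V E" and vs: "distinct vs" "set vs = V"
  shows "mat_trace (signless_laplacian E vs ^\<^sub>m 2) = real (first_zagreb V E) + 2 * real (card E)"
proof -
  let ?n = "length vs" and ?Q = "signless_laplacian E vs" and ?A = "adjacency_mat E vs"
  let ?d = "\<lambda>i. real (vertex_degree E (vs ! i))"
  have entry: "?Q $$ (i, j) * ?Q $$ (j, i) = (if j = i then (?d i)\<^sup>2 else 0) + ?A $$ (i, j)"
    if "i < ?n" "j < ?n" for i j
    using that adjacency_mat_diag[OF G] adjacency_mat_symmetric[of i vs j E]
    by (auto simp: signless_laplacian_entry adjacency_mat_idempotent_entry power2_eq_square)
  have "?Q ^\<^sub>m 2 = ?Q * ?Q"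
    by (simp add: numeral_2_eq_2 left_mult_one_mat[OF signless_laplacian_carrier])
  then have "mat_trace (?Q ^\<^sub>m 2) = (\<Sum>i<?n. \<Sum>j<?n. ?Q $$ (i, j) * ?Q $$ (j, i))"
    by (simp add: mat_trace_mult[OF signless_laplacian_carrier signless_laplacian_carrier])
  also have "\<dots> = (\<Sum>i<?n. (?d i)\<^sup>2 + ?d i)"
    by (simp add: entry sum.distrib adjacency_mat_row_sum[OF G vs])
  also have "\<dots> = real (first_zagreb V E) + 2 * real (card E)"
    using sum_enumeration[OF vs, of "\<lambda>v. (real (vertex_degree E v))\<^sup>2"]
    by (simp add: sum.distrib sum_degrees[OF G vs] first_zagreb_def)
  finally show ?thesis .
qed

text \<open>
  Writing each degree as a row sum of the adjacency matrix \<open>a\<close> turns the quadratic form into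
  \<open>\<Sum> a\<^sub>i\<^sub>j * (x\<^sub>i\<^sup>2 + x\<^sub>i * x\<^sub>j)\<close>. Adding the same sum with \<open>i\<close> and \<open>j\<close> exchanged completes the
  square, and the factor two accounts for each edge being met in both directions.
\<close>
lemma signless_laplacian_quadratic_form:
  assumes G: "simple_graph V E" and vs: "distinct vs" "set vs = V"
    and x: "x \<in> carrier_vec (length vs)"
  shows "2 * (x \<bullet> (signless_laplacian E vs *\<^sub>v x)) =
    (\<Sum>i<length vs. \<Sum>j<length vs. adjacency_mat E vs $$ (i, j) * (x $ i + x $ j)\<^sup>2)"
proof -
  let ?n = "length vs" and ?Q = "signless_laplacian E vs"
  let ?a = "\<lambda>i j. adjacency_mat E vs $$ (i, j)"
  let ?S = "\<Sum>i<?n. \<Sum>j<?n. ?a i j * ((x $ i)\<^sup>2 + x $ i * x $ j)"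
  have row: "(\<Sum>j<?n. ?Q $$ (i, j) * x $ j) = (\<Sum>j<?n. ?a i j * (x $ i + x $ j))" if i: "i < ?n" for i
  proof -
    have "(\<Sum>j<?n. ?Q $$ (i, j) * x $ j) =
        (\<Sum>j<?n. (if j = i then real (vertex_degree E (vs ! i)) * x $ i else 0) + ?a i j * x $ j)"
      using i by (intro sum.cong) (auto simp: signless_laplacian_entry algebra_simps)
    also have "\<dots> = (\<Sum>j<?n. ?a i j) * x $ i + (\<Sum>j<?n. ?a i j * x $ j)"
      using i by (simp add: sum.distrib adjacency_mat_row_sum[OF G vs])
    finally show ?thesis by (simp add: sum_distrib_right sum.distrib distrib_left)
  qed
  have "x \<bullet> (?Q *\<^sub>v x) = (\<Sum>i<?n. x $ i * (\<Sum>j<?n. ?Q $$ (i, j) * x $ j))"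
    using x by (simp add: scalar_prod_def atLeast0LessThan)
  also have "\<dots> = (\<Sum>i<?n. x $ i * (\<Sum>j<?n. ?a i j * (x $ i + x $ j)))" by (simp add: row)
  also have "\<dots> = ?S"
    unfolding sum_distrib_left by (intro sum.cong refl) (simp add: power2_eq_square algebra_simps)
  finally have form: "x \<bullet> (?Q *\<^sub>v x) = ?S" .
  have "?S = (\<Sum>i<?n. \<Sum>j<?n. ?a i j * ((x $ j)\<^sup>2 + x $ i * x $ j))"
    by (subst sum.swap) (auto intro!: sum.cong simp: adjacency_mat_symmetric[of _ vs _ E] mult.commute)
  then have "2 * ?S = ?S + (\<Sum>i<?n. \<Sum>j<?n. ?a i j * ((x $ j)\<^sup>2 + x $ i * x $ j))" by simp
  also have "\<dots> = (\<Sum>i<?n. \<Sum>j<?n. ?a i j * (x $ i + x $ j)\<^sup>2)"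
    unfolding sum.distrib[symmetric] by (intro sum.cong refl) (simp add: power2_eq_square algebra_simps)
  finally show ?thesis by (simp add: form)
qed

text \<open>
  For an eigenvector \<open>x\<close> with eigenvalue \<open>q\<close> the nonnegative quadratic form equals \<open>q * (x \<bullet> x)\<close>.
\<close>
lemma signless_laplacian_eigenvalue_nonneg:
  assumes G: "simple_graph V E" and vs: "distinct vs" "set vs = V"
    and qs: "eigenvalue_list (signless_laplacian E vs) qs" and q: "q \<in> set qs"
  shows "0 \<le> q"
proof -
  let ?Q = "signless_laplacian E vs"
  have "poly (char_poly ?Q) q = 0"
    using qs q by (auto simp: eigenvalue_list_def poly_prod_list prod_list_zero_iff)
  then have "eigenvalue ?Q q" by (simp add: eigenvalue_root_char_poly[OF signless_laplacian_carrier])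
  then obtain x where x: "x \<in> carrier_vec (length vs)" "x \<noteq> 0\<^sub>v (length vs)" "?Q *\<^sub>v x = q \<cdot>\<^sub>v x"
    by (auto simp: eigenvalue_def eigenvector_def)
  have "0 \<le> 2 * (x \<bullet> (?Q *\<^sub>v x))"
    unfolding signless_laplacian_quadratic_form[OF G vs x(1)]
    by (intro sum_nonneg mult_nonneg_nonneg adjacency_mat_nonneg) auto
  then have "0 \<le> q * (x \<bullet> x)" using x by simp
  moreover have "0 < x \<bullet> x" using conjugate_square_greater_0_vec[OF x(1)] x(2) by simp
  ultimately show ?thesis by (simp add: zero_le_mult_iff)
qed

section \<open>Entropies in terms of power sums\<close>

lemma sum_entropy_weight_powr:
  assumes "(\<Sum>j<length \<mu>. \<bar>\<mu> ! j\<bar>) = s"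
  shows "(\<Sum>i<length \<mu>. entropy_weight \<mu> i powr \<alpha>) = abs_power_sum \<alpha> \<mu> / s powr \<alpha>"
proof -
  have "0 \<le> s" using assms by (metis abs_ge_zero sum_nonneg)
  then show ?thesis
    by (simp add: entropy_weight_def assms abs_power_sum_def powr_divide sum_divide_distrib)
qed

lemma entropy1_eq:
  assumes "(\<Sum>j<length \<mu>. \<bar>\<mu> ! j\<bar>) = s" "s \<noteq> 0"
  shows "entropy1 \<mu> = 1 - (\<Sum>i<length \<mu>. (\<mu> ! i)\<^sup>2) / s\<^sup>2"
proof -
  have "entropy1 \<mu> = (\<Sum>i<length \<mu>. \<bar>\<mu> ! i\<bar> / s - (\<mu> ! i)\<^sup>2 / s\<^sup>2)"
    by (simp add: entropy1_def entropy_weight_def assms(1) right_diff_distrib power2_eq_square)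
  also have "\<dots> = (\<Sum>i<length \<mu>. \<bar>\<mu> ! i\<bar>) / s - (\<Sum>i<length \<mu>. (\<mu> ! i)\<^sup>2) / s\<^sup>2"
    by (simp add: sum_subtractf sum_divide_distrib)
  finally show ?thesis using assms by simp
qed

theorem theorem3p1:
  fixes V :: "'a set" and E :: "'a set set" and vs :: "'a list"
    and qs :: "real list" and b \<alpha> :: real and m :: nat
  assumes "simple_graph V E"
    and "distinct vs" and "set vs = V"
    and "m = card E" and "m \<ge> 1"
    and "eigenvalue_list (signless_laplacian E vs) qs"
    and "b > 1"
    and "\<alpha> \<noteq> 1"
  shows "entropy1 qs = 1 - 1 / (4 * real m ^ 2) * (real (first_zagreb V E) + 2 * real m) \<and>
         entropy2 b \<alpha> qs =
           1 / (1 - \<alpha>) * log b (abs_power_sum \<alpha> qs / (2 * real m) powr \<alpha>) \<and>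
         entropy3 \<alpha> qs =
           1 / (2 powr (1 - \<alpha>) - 1) * (abs_power_sum \<alpha> qs / (2 * real m) powr \<alpha> - 1)"
proof -
  let ?Q = "signless_laplacian E vs"
  note graph = assms(1-3)
  note power_sums = mat_trace_pow_eigenvalue_list[OF signless_laplacian_carrier assms(6)]
  have "?Q ^\<^sub>m 1 = ?Q"
    by (simp add: left_mult_one_mat[OF signless_laplacian_carrier])
  then have "(\<Sum>i<length qs. qs ! i) = 2 * real m"
    using power_sums[of 1] trace_signless_laplacian[OF graph] assms(4) by simp
  moreover have "\<bar>qs ! i\<bar> = qs ! i" if "i < length qs" for i
    using that signless_laplacian_eigenvalue_nonneg[OF graph assms(6)] by simp
  ultimately have abs_sum: "(\<Sum>i<length qs. \<bar>qs ! i\<bar>) = 2 * real m" by simp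
  have "(\<Sum>i<length qs. (qs ! i)\<^sup>2) = real (first_zagreb V E) + 2 * real m"
    using power_sums[of 2] trace_signless_laplacian_square[OF graph] assms(4) by simp
  then have "entropy1 qs = 1 - 1 / (4 * real m ^ 2) * (real (first_zagreb V E) + 2 * real m)"
    using entropy1_eq[OF abs_sum] assms(5) by (simp add: power_mult_distrib)
  then show ?thesis
    by (simp add: entropy2_def entropy3_def sum_entropy_weight_powr[OF abs_sum])
qed

end
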